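(* Let $n\in\mathbb N_0$, $\lambda\in\mathbb C$ with $\lambda\notin\{-1,-2,-3,\ldots\}$, and $x\in(-1,1)$. Then $${\sf P}_{n+\lambda}^{-\lambda}(x)=\frac{(1-x^2)^{\frac{\lambda}{2}}}{2^\lambda\,\Gamma(\lambda+1)}\,M_n\left(-2\lambda-n-1;\lambda+1,\frac{2}{1+x}\right).$$
   Context: $\mathbb N_0=\{0,1,2,\ldots\}$. ${}_2F_1(a,b;c;z)=\sum_{k\ge0}\frac{(a)_k(b)_k}{(c)_k}\frac{z^k}{k!}$ with $(a)_0=1$, $(a)_k=a(a+1)\cdots(a+k-1)$. The Meixner polynomials are $M_n(y;\beta,c)={}_2F_1\left(-n,-y;\beta;1-\frac1c\right)$, for $n\in\mathbb N_0$, $c\in\mathbb C\setminus\{0,1\}$. The Ferrers function of the first kind is, for $\nu,\mu\in\mathbb C$ and $x\in(-1,1)$, $${\sf P}_\nu^{-\mu}(x)=\frac{1}{\Gamma(\mu+1)}\left(\frac{1-x}{1+x}\right)^{\frac{\mu}{2}}{}_2F_1\left(-\nu,\nu+1;\mu+1;\frac{1-x}{2}\right).$$ Powers of positive reals are principal. *)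

theory Defs
  imports "HOL-Analysis.Analysis"
begin

text \<open>
  The Gauss hypergeometric series. Its value is meaningful where the series converges (in
  particular for \<open>norm z < 1\<close>, or for every \<open>z\<close> when it terminates) and where \<open>c\<close> is not a
  non-positive integer, which would make a factor \<open>pochhammer c k\<close> vanish.
\<close>
definition hyp2F1 :: "complex \<Rightarrow> complex \<Rightarrow> complex \<Rightarrow> complex \<Rightarrow> complex" where
  "hyp2F1 a b c z =
     (\<Sum>k. pochhammer a k * pochhammer b k / pochhammer c k * (z ^ k / fact k))"

definition meixner :: "nat \<Rightarrow> complex \<Rightarrow> complex \<Rightarrow> complex \<Rightarrow> complex" where
  "meixner n y \<beta> c = hyp2F1 (- of_nat n) (- y) \<beta> (1 - 1 / c)"

text \<open>
  The Ferrers function of the first kind of degree \<open>\<nu>\<close> and order \<open>-\<mu>\<close>, for \<open>-1 < x < 1\<close>. The second argument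
  is \<open>\<mu>\<close>, i.e. the negative of the order. It is not regularised: it is meaningful only if
  \<open>\<mu> + 1\<close> is not a non-positive integer.
\<close>
definition ferrers_P_neg :: "complex \<Rightarrow> complex \<Rightarrow> real \<Rightarrow> complex" where
  "ferrers_P_neg \<nu> \<mu> x =
     1 / Gamma (\<mu> + 1) * complex_of_real ((1 - x) / (1 + x)) powr (\<mu> / 2) *
     hyp2F1 (- \<nu>) (\<nu> + 1) (\<mu> + 1) (complex_of_real ((1 - x) / 2))"

end

theory Submission
  imports Defs
begin

text \<open>
  With \<open>z = (1 - x) / 2\<close>, the two sides contain \<open>F(-n - \<lambda>, n + \<lambda> + 1; \<lambda> + 1; z)\<close> and the polynomial
  \<open>F(2\<lambda> + n + 1, -n; \<lambda> + 1; z)\<close>, where \<open>F\<close> is the Gauss hypergeometric series. Euler's transformation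
  \<open>F(a, b; c; z) = (1 - z)\<^sup>s F(c - a, c - b; c; z)\<close> with \<open>s = c - a - b\<close> relates them by the factor
  \<open>(1 - z)\<^sup>\<lambda> = ((1 + x) / 2)\<^sup>\<lambda>\<close>, and the powers of \<open>1 - x\<close> and \<open>1 + x\<close> then combine because all bases
  are positive.

  Euler's transformation is proved for formal power series. The hypergeometric differential
  operator \<open>L(a, b, c)\<close> satisfies
  \<open>L(a, b, c) ((1 - X)\<^sup>s g) = (1 - X)\<^sup>s L(c - a, c - b, c) g\<close>, so both sides of Euler's identity are
  annihilated by \<open>L(a, b, c)\<close>. On coefficients this is a first-order recurrence, and it
  determines a solution from its constant term unless \<open>c\<close> is a non-positive integer. Since
  the series on the right converge for \<open>|z| < 1\<close>, the formal identity can be evaluated there.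
\<close>

section \<open>The hypergeometric differential operator on formal power series\<close>

text \<open>
  The operator \<open>X (1 - X) f'' + (c - (a + b + 1) X) f' - a b f\<close>. When \<open>c\<close> is not a non-positive
  integer, its kernel contains the formal Gauss series \<open>fps_hypergeo [a, b] [c] 1\<close>.
\<close>
definition hyp2F1_op :: "'a::field_char_0 \<Rightarrow> 'a \<Rightarrow> 'a \<Rightarrow> 'a fps \<Rightarrow> 'a fps" where
  "hyp2F1_op a b c f =
     fps_X * (1 - fps_X) * fps_deriv (fps_deriv f)
     + (fps_const c - fps_const (a + b + 1) * fps_X) * fps_deriv f - fps_const (a * b) * f"

lemma hyp2F1_op_nth:
  "fps_nth (hyp2F1_op a b c f) n =
     of_nat (Suc n) * (c + of_nat n) * fps_nth f (Suc n)
     - (a + of_nat n) * (b + of_nat n) * fps_nth f n"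
proof -
  have eq: "hyp2F1_op a b c f =
      fps_X * fps_deriv (fps_deriv f) - fps_X * (fps_X * fps_deriv (fps_deriv f))
      + fps_const c * fps_deriv f - fps_const (a + b + 1) * (fps_X * fps_deriv f)
      - fps_const (a * b) * f"
    unfolding hyp2F1_op_def by (simp only: ring_distribs mult_1_left mult_1_right mult.assoc) algebra
  show ?thesis
    unfolding eq by (cases n; cases "n - 1") (simp_all add: algebra_simps)
qed

lemma hyp2F1_op_eq_0_iff:
  "hyp2F1_op a b c f = 0 \<longleftrightarrow>
     (\<forall>n. of_nat (Suc n) * (c + of_nat n) * fps_nth f (Suc n) =
        (a + of_nat n) * (b + of_nat n) * fps_nth f n)"
  by (simp add: fps_eq_iff hyp2F1_op_nth del: of_nat_Suc)

lemma hyp2F1_op_fps_hypergeo: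
  assumes "\<And>k. c \<noteq> - of_nat k"
  shows "hyp2F1_op a b c (fps_hypergeo [a, b] [c] 1) = 0"
  unfolding hyp2F1_op_eq_0_iff
proof
  fix n
  have "c + of_nat n \<noteq> 0"
    using assms[of n] by (simp add: eq_neg_iff_add_eq_0)
  then show "of_nat (Suc n) * (c + of_nat n) * fps_nth (fps_hypergeo [a, b] [c] 1) (Suc n) =
      (a + of_nat n) * (b + of_nat n) * fps_nth (fps_hypergeo [a, b] [c] 1) n"
    by (subst fps_hypergeo_rec) (simp del: of_nat_Suc fps_hypergeo_nth)
qed

lemma hyp2F1_op_eq_0_unique:
  assumes c: "\<And>k. c \<noteq> - of_nat k"
    and f: "hyp2F1_op a b c f = 0" and g: "hyp2F1_op a b c g = 0"
    and init: "fps_nth f 0 = fps_nth g 0"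
  shows "f = g"
proof (rule fps_ext)
  fix n
  show "fps_nth f n = fps_nth g n"
  proof (induction n)
    case 0
    show ?case by (rule init)
  next
    case (Suc n)
    have "of_nat (Suc n) * (c + of_nat n) * fps_nth f (Suc n) =
        of_nat (Suc n) * (c + of_nat n) * fps_nth g (Suc n)"
      using f g Suc.IH unfolding hyp2F1_op_eq_0_iff by metis
    moreover have "of_nat (Suc n) * (c + of_nat n) \<noteq> 0"
      using c[of n] by (simp add: eq_neg_iff_add_eq_0 del: of_nat_Suc)
    ultimately show ?case by simp
  qed
qed

section \<open>Euler's transformation\<close>

text \<open>
  The binomial series \<open>(1 - X)\<^sup>s\<close> is written as the hypergeometric series
  \<open>fps_hypergeo [- s] [] 1\<close>.
\<close>
lemma fps_deriv_one_minus_X_powr: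
  "(1 - fps_X) * fps_deriv (fps_hypergeo [- s] [] 1) =
     - (fps_const s * fps_hypergeo [- s] [] (1::'a::field_char_0))"
proof (rule fps_ext)
  fix n
  let ?B = "fps_hypergeo [- s] [] 1 :: 'a fps"
  have "of_nat (Suc n) * fps_nth ?B (Suc n) = (of_nat n - s) * fps_nth ?B n"
    by (subst fps_hypergeo_rec) (simp del: of_nat_Suc fps_hypergeo_nth)
  moreover have "(1 - fps_X) * fps_deriv ?B = fps_deriv ?B - fps_X * fps_deriv ?B"
    by (simp add: algebra_simps)
  ultimately show "fps_nth ((1 - fps_X) * fps_deriv ?B) n = fps_nth (- (fps_const s * ?B)) n"
    by (cases n) (simp_all add: algebra_simps del: fps_hypergeo_nth)
qed

text \<open>
  The conjugation identity behind Euler's transformation. The derivatives of \<open>(1 - X)\<^sup>s\<close> are known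
  only after multiplication by \<open>1 - X\<close>, so the identity is checked after multiplication by
  \<open>1 - X\<close>, which is then cancelled.
\<close>
lemma hyp2F1_op_one_minus_X_powr_mult:
  fixes a b c :: "'a::field_char_0"
  shows "hyp2F1_op a b c (fps_hypergeo [- (c - a - b)] [] 1 * g) =
     fps_hypergeo [- (c - a - b)] [] 1 * hyp2F1_op (c - a) (c - b) c g"
proof -
  define B where "B = fps_hypergeo [- (c - a - b)] [] (1::'a)"
  define B1 where "B1 = fps_deriv B"
  define B2 where "B2 = fps_deriv B1"
  define U where "U = (1 - fps_X :: 'a fps)"
  define A C E where "A = fps_const a" and "C = fps_const b" and "E = fps_const c"
  define g1 where "g1 = fps_deriv g"
  define g2 where "g2 = fps_deriv g1"
  have const: "fps_const (a + b + 1) = A + C + 1" "fps_const (c - a - b) = E - A - C"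
    "fps_const (c - a + (c - b) + 1) = (E - A) + (E - C) + 1"
    "fps_const (a * b) = A * C" "fps_const ((c - a) * (c - b)) = (E - A) * (E - C)"
    by (simp_all add: A_def C_def E_def flip: fps_const_1_eq_1)
  have dU: "fps_deriv U = - 1" and X: "fps_X = 1 - U"
    by (simp_all add: U_def)
  have dconst: "fps_deriv (E - A - C) = 0"
    by (simp add: A_def C_def E_def)
  have B1: "U * B1 = - ((E - A - C) * B)"
    unfolding U_def B1_def B_def fps_deriv_one_minus_X_powr const ..
  then have "fps_deriv (U * B1) = fps_deriv (- ((E - A - C) * B))"
    by (rule arg_cong)
  then have B2: "U * B2 = B1 - (E - A - C) * B1"
    unfolding fps_deriv_mult fps_deriv_neg dU dconst B1_def[symmetric] B2_def[symmetric]
    by algebra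
  have l: "hyp2F1_op a b c (B * g) = (1 - U) * U * (B2 * g + 2 * (B1 * g1) + B * g2)
      + (E - (A + C + 1) * (1 - U)) * (B1 * g + B * g1) - A * C * (B * g)"
    unfolding hyp2F1_op_def const fps_deriv_mult fps_deriv_add
      U_def[symmetric] B1_def[symmetric] B2_def[symmetric] g1_def[symmetric] g2_def[symmetric]
      E_def[symmetric] X by algebra
  have r: "hyp2F1_op (c - a) (c - b) c g = (1 - U) * U * g2
      + (E - ((E - A) + (E - C) + 1) * (1 - U)) * g1 - (E - A) * (E - C) * g"
    unfolding hyp2F1_op_def const U_def[symmetric] g1_def[symmetric] g2_def[symmetric]
      E_def[symmetric] X by algebra
  have "U * hyp2F1_op a b c (B * g) = U * (B * hyp2F1_op (c - a) (c - b) c g)"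
    unfolding l r using B1 B2 by algebra
  moreover have "U \<noteq> 0"
    using arg_cong[of U 0 "\<lambda>f. fps_nth f 0"] by (auto simp: U_def)
  ultimately show ?thesis
    by (simp add: B_def)
qed

lemma fps_hypergeo_Euler_transformation:
  fixes a b c :: "'a::field_char_0"
  assumes c: "\<And>k. c \<noteq> - of_nat k"
  shows "fps_hypergeo [a, b] [c] 1 =
    fps_hypergeo [- (c - a - b)] [] 1 * fps_hypergeo [c - a, c - b] [c] 1"
proof (rule hyp2F1_op_eq_0_unique[OF c])
  show "hyp2F1_op a b c (fps_hypergeo [a, b] [c] 1) = 0"
    by (rule hyp2F1_op_fps_hypergeo[OF c])
  show "hyp2F1_op a b c
      (fps_hypergeo [- (c - a - b)] [] 1 * fps_hypergeo [c - a, c - b] [c] 1) = 0"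
    unfolding hyp2F1_op_one_minus_X_powr_mult hyp2F1_op_fps_hypergeo[OF c] by simp
qed (simp add: fps_mult_nth_0)

text \<open>
  If \<open>a\<close> or \<open>b\<close> is a non-positive integer, the series terminates and the ratio test does not
  apply.
\<close>
lemma fps_conv_radius_fps_hypergeo_2F1:
  fixes a b c :: complex
  assumes c: "\<And>k. c \<noteq> - of_nat k"
  shows "fps_conv_radius (fps_hypergeo [a, b] [c] 1) \<ge> 1"
proof (cases "\<exists>m. a = - of_nat m \<or> b = - of_nat m")
  case True
  then obtain m where m: "a = - of_nat m \<or> b = - of_nat m" by blast
  have "\<forall>\<^sub>F k in sequentially. fps_nth (fps_hypergeo [a, b] [c] 1) k = 0"
    using eventually_gt_at_top[of m]
    by eventually_elim (use m in \<open>auto simp: pochhammer_of_nat_eq_0_lemma\<close>)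
  then have "conv_radius (fps_nth (fps_hypergeo [a, b] [c] 1)) = conv_radius (\<lambda>_. 0 :: complex)"
    by (rule conv_radius_cong')
  then show ?thesis
    by (simp add: fps_conv_radius_def)
next
  case False
  have nz: "d + of_nat k \<noteq> 0" if "\<And>m. d \<noteq> - of_nat m" for d :: complex and k
    using that[of k] by (simp add: eq_neg_iff_add_eq_0)
  have a: "a + of_nat k \<noteq> 0" and b: "b + of_nat k \<noteq> 0" and c': "c + of_nat k \<noteq> 0" for k
    using False c by (auto intro!: nz)
  let ?f = "fps_nth (fps_hypergeo [a, b] [c] 1)"
  have lim: "(\<lambda>k. (d + of_nat k) / (e + of_nat k)) \<longlonglongrightarrow> 1" if e: "\<And>k. e + of_nat k \<noteq> 0"
    for d e :: complex
  proof -
    have "(\<lambda>k. 1 + (d - e) / (e + of_nat k)) \<longlonglongrightarrow> 1 + 0"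
      by (intro tendsto_intros tendsto_divide_0[OF tendsto_const]
          tendsto_add_filterlim_at_infinity[OF tendsto_const tendsto_of_nat])
    moreover have "1 + (d - e) / (e + of_nat k) = (d + of_nat k) / (e + of_nat k)" for k
      using e[of k] by (simp add: divide_simps)
    ultimately show ?thesis by simp
  qed
  have f0: "?f k \<noteq> 0" for k
    using False c by (auto simp: pochhammer_eq_0_iff)
  have ratio: "?f k / ?f (Suc k) =
      (c + of_nat k) / (a + of_nat k) * ((1 + of_nat k) / (b + of_nat k))" for k
  proof -
    have "?f (Suc k) = (a + of_nat k) * (b + of_nat k) / ((1 + of_nat k) * (c + of_nat k)) * ?f k"
      by (subst fps_hypergeo_rec) (simp del: fps_hypergeo_nth)
    moreover have "1 + of_nat k \<noteq> (0 :: complex)"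
      using of_nat_neq_0[of k, where ?'a = complex] by simp
    ultimately show ?thesis
      using f0[of k] f0[of "Suc k"] a[of k] b[of k] c'[of k]
      by (simp add: divide_simps mult_ac del: fps_hypergeo_nth)
  qed
  have "(\<lambda>k. ?f k / ?f (Suc k)) \<longlonglongrightarrow> 1"
    unfolding ratio using tendsto_mult[OF lim[OF a] lim[OF b]] by simp
  then have "(\<lambda>k. norm (?f k) / norm (?f (Suc k))) \<longlonglongrightarrow> 1"
    by (auto dest: tendsto_norm simp: norm_divide simp del: fps_hypergeo_nth)
  then show ?thesis
    by (auto simp: fps_conv_radius_def dest: conv_radius_ratio_limit_nonzero[OF refl, rotated]
        simp del: fps_hypergeo_nth)
qed

lemma one_minus_X_powr_sums:
  fixes s z :: complex
  assumes "norm z < 1"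
  shows "(\<lambda>k. fps_nth (fps_hypergeo [- s] [] 1) k * z ^ k) sums (1 - z) powr s"
proof -
  have "(\<lambda>k. (s gchoose k) * (- z) ^ k) sums (1 + (- z)) powr s"
    using assms by (intro gen_binomial_complex) simp
  moreover have "(s gchoose k) * (- z) ^ k = fps_nth (fps_hypergeo [- s] [] 1) k * z ^ k" for k
    by (simp add: gbinomial_pochhammer flip: power_mult_distrib)
  ultimately show ?thesis by simp
qed

lemma hyp2F1_commute: "hyp2F1 a b c z = hyp2F1 b a c z"
  unfolding hyp2F1_def by (simp only: mult.commute[of "pochhammer a _"])

lemma hyp2F1_eq_eval_fps: "hyp2F1 a b c z = eval_fps (fps_hypergeo [a, b] [c] 1) z"
  by (simp add: hyp2F1_def eval_fps_def)

lemma hyp2F1_Euler_transformation: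
  assumes c: "\<And>k. c \<noteq> - of_nat k" and z: "norm z < 1"
  shows "hyp2F1 a b c z = (1 - z) powr (c - a - b) * hyp2F1 (c - a) (c - b) c z"
proof -
  let ?B = "fps_hypergeo [- (c - a - b)] [] (1::complex)"
  have "summable (\<lambda>k. fps_nth ?B k * w ^ k)" if "norm w < 1" for w
    using one_minus_X_powr_sums[OF that] by (rule sums_summable)
  then have "fps_conv_radius ?B \<ge> 1"
    unfolding fps_conv_radius_def
    by (intro conv_radius_geI_ex') (simp del: fps_hypergeo_nth add: one_ereal_def)
  moreover have "fps_conv_radius (fps_hypergeo [c - a, c - b] [c] 1) \<ge> 1"
    by (rule fps_conv_radius_fps_hypergeo_2F1[OF c])
  moreover have "ereal (norm z) < 1"
    using z by simp
  ultimately have "ereal (norm z) < fps_conv_radius ?B"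
    and "ereal (norm z) < fps_conv_radius (fps_hypergeo [c - a, c - b] [c] 1)"
    by (blast intro: less_le_trans)+
  then have "hyp2F1 a b c z = eval_fps ?B z * hyp2F1 (c - a) (c - b) c z"
    unfolding hyp2F1_eq_eval_fps fps_hypergeo_Euler_transformation[OF c, of a b]
    by (rule eval_fps_mult)
  moreover have "eval_fps ?B z = (1 - z) powr (c - a - b)"
    using one_minus_X_powr_sums[OF z] unfolding eval_fps_def by (rule sums_unique[symmetric])
  ultimately show ?thesis by simp
qed

section \<open>Ferrers functions as Meixner polynomials\<close>

lemma ferrers_prefactor_eq:
  fixes lam :: complex and x :: real
  assumes "x \<in> {-1<..<1}"
  shows "complex_of_real ((1 - x) / (1 + x)) powr (lam / 2) *
      complex_of_real ((1 + x) / 2) powr lam =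
    complex_of_real (1 - x\<^sup>2) powr (lam / 2) / 2 powr lam"
proof -
  have pos: "1 - x > 0" "1 + x > 0" using assms by auto
  have square: "1 - x\<^sup>2 = (1 - x) * (1 + x)"
    by (simp add: power2_eq_square algebra_simps)
  then have ln_square: "ln (1 - x\<^sup>2) = ln (1 - x) + ln (1 + x)"
    using pos by (simp add: ln_mult)
  have powr: "complex_of_real y powr t = exp (t * complex_of_real (ln y))" if "y > 0" for y t
    using that by (simp add: powr_def Ln_of_real)
  have "1 - x\<^sup>2 > 0"
    unfolding square using pos by simp
  then have "complex_of_real (1 - x\<^sup>2) powr (lam / 2) / complex_of_real 2 powr lam =
      exp (lam / 2 * complex_of_real (ln (1 - x) + ln (1 + x)) - lam * complex_of_real (ln 2))"
    by (simp only: powr exp_diff ln_square zero_less_numeral)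
  moreover have "complex_of_real ((1 - x) / (1 + x)) powr (lam / 2) *
      complex_of_real ((1 + x) / 2) powr lam =
      exp (lam / 2 * complex_of_real (ln (1 - x) - ln (1 + x))
        + lam * complex_of_real (ln (1 + x) - ln 2))"
    using pos by (simp add: powr ln_div exp_add del: of_real_divide of_real_diff)
  moreover have "lam / 2 * complex_of_real (ln (1 - x) - ln (1 + x))
        + lam * complex_of_real (ln (1 + x) - ln 2) =
      lam / 2 * complex_of_real (ln (1 - x) + ln (1 + x)) - lam * complex_of_real (ln 2)"
    by (simp add: field_simps)
  ultimately show ?thesis by simp
qed

theorem corollary1p8:
  fixes n :: nat and lam :: complex and x :: real
  assumes "lam \<notin> {- of_nat k | k :: nat. k \<ge> 1}"
    and "x \<in> {-1<..<1}"
  shows "ferrers_P_neg (of_nat n + lam) lam x =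
    complex_of_real (1 - x\<^sup>2) powr (lam / 2) / (2 powr lam * Gamma (lam + 1)) *
    meixner n (- 2 * lam - of_nat n - 1) (lam + 1) (complex_of_real (2 / (1 + x)))"
proof -
  define z where "z = complex_of_real ((1 - x) / 2)"
  have c: "lam + 1 \<noteq> - of_nat k" for k
  proof
    assume "lam + 1 = - of_nat k"
    then have "lam = - of_nat (Suc k)"
      by (simp add: algebra_simps eq_neg_iff_add_eq_0)
    moreover have "1 \<le> Suc k" by simp
    ultimately show False using assms(1) by blast
  qed
  have z: "norm z < 1"
    unfolding z_def norm_of_real using assms(2) by auto
  have "hyp2F1 (- (of_nat n + lam)) (of_nat n + lam + 1) (lam + 1) z =
      (1 - z) powr lam * hyp2F1 (2 * lam + of_nat n + 1) (- of_nat n) (lam + 1) z"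
    using hyp2F1_Euler_transformation[OF c z, of "- (of_nat n + lam)" "of_nat n + lam + 1"]
    by (simp add: algebra_simps)
  moreover have "1 - z = complex_of_real ((1 + x) / 2)"
    by (simp add: z_def field_simps)
  moreover have "meixner n (- 2 * lam - of_nat n - 1) (lam + 1) (complex_of_real (2 / (1 + x))) =
      hyp2F1 (2 * lam + of_nat n + 1) (- of_nat n) (lam + 1) z"
  proof -
    have "1 - 1 / complex_of_real (2 / (1 + x)) = z"
      using assms(2) by (simp add: z_def field_simps)
    moreover have "- (- 2 * lam - of_nat n - 1) = 2 * lam + of_nat n + 1"
      by simp
    ultimately show ?thesis
      unfolding meixner_def by (simp only: hyp2F1_commute)
  qed
  ultimately have "ferrers_P_neg (of_nat n + lam) lam x =
      1 / Gamma (lam + 1) *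
      (complex_of_real ((1 - x) / (1 + x)) powr (lam / 2) * complex_of_real ((1 + x) / 2) powr lam) *
      meixner n (- 2 * lam - of_nat n - 1) (lam + 1) (complex_of_real (2 / (1 + x)))"
    by (simp only: ferrers_P_neg_def flip: z_def) (simp only: mult.assoc)
  then show ?thesis
    unfolding ferrers_prefactor_eq[OF assms(2)] by (simp add: mult.commute)
qed

end
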